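(* Let $r>0$, and for every $d\in\mathbb{N}$ let $S=S_d\in\{1,\dots,d\}$. The $L_\infty$-recovery of ridge functions from the classes $R_d^{r,1}$, and likewise from the classes $R_d^{r,(1,S)}$, using deterministic sampling algorithms suffers from the curse of dimensionality; that is, for $F_d=R_d^{r,1}$ and for $F_d=R_d^{r,(1,S)}$ there are $C>0$, $\gamma>1$ and $\varepsilon_0>0$ such that $$n(\varepsilon,F_d)\ge C\gamma^d\qquad\text{for all }0<\varepsilon\le\varepsilon_0\text{ and infinitely many }d\in\mathbb{N}.$$
   Context: $\|a\|_p=(\sum_{i=1}^d|a_i|^p)^{1/p}$. For $r>0$ let $m$ be the largest integer strictly less than $r$ and $\beta=r-m\in(0,1]$. $B^{\mathrm{Lip}(r)}$ is the set of all $m$ times continuously differentiable $g:[-1,1]\to\mathbb{R}$ with $\max\{\|g\|_\infty,\|g^{(1)}\|_\infty,\dots,\|g^{(m)}\|_\infty,|g^{(m)}|_\beta\}\le 1$, where $|g^{(m)}|_\beta=\sup_{u\ne v\in[-1,1]}\frac{|g^{(m)}(u)-g^{(m)}(v)|}{2\min\{1,|u-v|\}^\beta}$. $R_d^{r,1}$ is the set of $f:[-1,1]^d\to\mathbb{R}$, $f(x)=g(a^{T}x)$ with $g\in B^{\mathrm{Lip}(r)}$, $a\in\mathbb{R}^d$, $\|a\|_1=1$. $R_d^{r,(p,S)}$ (here $p=1$) is the set of $f:[-1,1]^d\to\mathbb{R}$, $f(x)=g(a^{T}x)$ with $g\in B^{\mathrm{Lip}(r)}$ and $a\in\mathbb{R}^d$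 satisfying $\|a\|_p\le 1$ and $\|a\|_1\ge\min\{1,4S^{1-1/p}\}$. For a class $F_d\subset C([-1,1]^d)$, a deterministic algorithm using at most $n$ function values is a map $S_n:F_d\to C([-1,1]^d)$ of the form $S_n(f)=\phi(f(x_1),\dots,f(x_n))$ with an arbitrary map $\phi:\mathbb{R}^n\to C([-1,1]^d)$, where $x_1\in[-1,1]^d$ is fixed (independent of $f$) and $x_i=\psi_i(f(x_1),\dots,f(x_{i-1}))$ for $i=2,\dots,n$ with arbitrary maps $\psi_i:\mathbb{R}^{i-1}\to[-1,1]^d$. Put $\mathrm{err}(n,F_d)=\inf_{S_n}\sup_{f\in F_d}\|f-S_n(f)\|_\infty$ (infimum over all such algorithms) and $n(\varepsilon,F_d)=\min\{n\in\mathbb{N}:\mathrm{err}(n,F_d)\le\varepsilon\}$. *)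

theory Defs
  imports "HOL-Analysis.Analysis"
begin

text \<open>
  The dimension varies inside the statement, so vectors of length \<open>d\<close> are functions in
  \<open>{..<d} \<rightarrow>\<^sub>E UNIV\<close>, and functions on the cube are extensional on it. On such vectors the
  product topology of \<open>nat \<Rightarrow> real\<close> is the usual topology of \<open>d\<close>-dimensional space.
\<close>

definition cube :: "nat \<Rightarrow> (nat \<Rightarrow> real) set" where
  "cube d = {..<d} \<rightarrow>\<^sub>E {-1..1}"

definition cont_cube :: "nat \<Rightarrow> ((nat \<Rightarrow> real) \<Rightarrow> real) set" where
  "cont_cube d = {h \<in> extensional (cube d). continuous_on (cube d) h}"

definition sup_norm :: "'a set \<Rightarrow> ('a \<Rightarrow> real) \<Rightarrow> ennreal" where
  "sup_norm X h = (SUP x\<in>X. ennreal \<bar>h x\<bar>)"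

definition lp_norm :: "real \<Rightarrow> nat \<Rightarrow> (nat \<Rightarrow> real) \<Rightarrow> real" where
  "lp_norm p d a = (\<Sum>i<d. \<bar>a i\<bar> powr p) powr (1 / p)"

text \<open>Derivatives on \<open>[-1,1]\<close> are one-sided at the end points.\<close>

definition nderiv :: "nat \<Rightarrow> (real \<Rightarrow> real) \<Rightarrow> real \<Rightarrow> real" where
  "nderiv k g = ((\<lambda>h u. vector_derivative h (at u within {-1..1})) ^^ k) g"

definition cont_differentiable :: "nat \<Rightarrow> (real \<Rightarrow> real) \<Rightarrow> bool" where
  "cont_differentiable m g \<longleftrightarrow>
     (\<forall>k<m. nderiv k g differentiable_on {-1..1}) \<and> continuous_on {-1..1} (nderiv m g)"

definition holder_seminorm :: "real \<Rightarrow> (real \<Rightarrow> real) \<Rightarrow> ennreal" where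
  "holder_seminorm \<beta> h =
     (SUP (u, v) \<in> {(u, v). u \<in> {-1..1} \<and> v \<in> {-1..1} \<and> u \<noteq> v}.
        ennreal (\<bar>h u - h v\<bar> / (2 * min 1 \<bar>u - v\<bar> powr \<beta>)))"

definition lip_order :: "real \<Rightarrow> nat" where
  "lip_order r = (GREATEST m. real m < r)"

definition lip_ball :: "real \<Rightarrow> (real \<Rightarrow> real) set" where
  "lip_ball r = (let m = lip_order r; \<beta> = r - real m in
     {g. cont_differentiable m g \<and>
         Max (insert (holder_seminorm \<beta> (nderiv m g))
                     ((\<lambda>k. sup_norm {-1..1} (nderiv k g)) ` {..m})) \<le> 1})"

definition ridge :: "nat \<Rightarrow> (real \<Rightarrow> real) \<Rightarrow> (nat \<Rightarrow> real) \<Rightarrow> (nat \<Rightarrow> real) \<Rightarrow> real" where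
  "ridge d g a = (\<lambda>x\<in>cube d. g (\<Sum>i<d. a i * x i))"

definition ridge_class :: "real \<Rightarrow> nat \<Rightarrow> ((nat \<Rightarrow> real) \<Rightarrow> real) set" where
  "ridge_class r d =
     {ridge d g a | g a. g \<in> lip_ball r \<and> a \<in> {..<d} \<rightarrow>\<^sub>E UNIV \<and> lp_norm 1 d a = 1}"

definition ridge_class_lp ::
  "real \<Rightarrow> real \<Rightarrow> nat \<Rightarrow> nat \<Rightarrow> ((nat \<Rightarrow> real) \<Rightarrow> real) set" where
  "ridge_class_lp r p S d =
     {ridge d g a | g a. g \<in> lip_ball r \<and> a \<in> {..<d} \<rightarrow>\<^sub>E UNIV \<and> lp_norm p d a \<le> 1 \<and>
        lp_norm 1 d a \<ge> min 1 (4 * real S powr (1 - 1 / p))}"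

text \<open>
  The point-selection maps, one for each number of values already observed, are combined into a
  single map \<open>\<psi>\<close> on lists; the first point is \<open>\<psi> []\<close>.
\<close>

primrec observed :: "(real list \<Rightarrow> 'a) \<Rightarrow> ('a \<Rightarrow> real) \<Rightarrow> nat \<Rightarrow> real list" where
  "observed \<psi> f 0 = []"
| "observed \<psi> f (Suc k) = observed \<psi> f k @ [f (\<psi> (observed \<psi> f k))]"

definition sampling_algorithms ::
  "nat \<Rightarrow> nat \<Rightarrow> (((nat \<Rightarrow> real) \<Rightarrow> real) \<Rightarrow> (nat \<Rightarrow> real) \<Rightarrow> real) set" where
  "sampling_algorithms d n =
     {(\<lambda>f. \<phi> (observed \<psi> f n)) | \<phi> \<psi>.
        (\<forall>ys. length ys = n \<longrightarrow> \<phi> ys \<in> cont_cube d) \<and>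
        (\<forall>ys. length ys < n \<longrightarrow> \<psi> ys \<in> cube d)}"

definition sampling_err :: "nat \<Rightarrow> nat \<Rightarrow> ((nat \<Rightarrow> real) \<Rightarrow> real) set \<Rightarrow> ennreal" where
  "sampling_err d n F =
     (INF A\<in>sampling_algorithms d n. SUP f\<in>F. sup_norm (cube d) (\<lambda>x. f x - A f x))"

text \<open>The infimum is attained if the set is nonempty; otherwise it is \<open>\<infinity>\<close>.\<close>

definition info_complexity :: "nat \<Rightarrow> real \<Rightarrow> ((nat \<Rightarrow> real) \<Rightarrow> real) set \<Rightarrow> enat" where
  "info_complexity d \<epsilon> F = (INF n \<in> {n. sampling_err d n F \<le> ennreal \<epsilon>}. enat n)"

definition curse_of_dimensionality :: "(nat \<Rightarrow> ((nat \<Rightarrow> real) \<Rightarrow> real) set) \<Rightarrow> bool" where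
  "curse_of_dimensionality F \<longleftrightarrow>
     (\<exists>C \<gamma> \<epsilon>\<^sub>0 :: real. C > 0 \<and> \<gamma> > 1 \<and> \<epsilon>\<^sub>0 > 0 \<and>
        (\<exists>\<^sub>\<infinity>d. \<forall>\<epsilon>. 0 < \<epsilon> \<and> \<epsilon> \<le> \<epsilon>\<^sub>0 \<longrightarrow>
           ereal_of_enat (info_complexity d \<epsilon> (F d)) \<ge> ereal (C * \<gamma> ^ d)))"

end

theory Submission
  imports Defs
begin

text \<open>
  The curse is caused by the \<open>2 ^ d\<close> directions \<open>a = \<sigma> / d\<close> with a sign vector \<open>\<sigma>\<close>, all of which
  satisfy \<open>\<parallel>a\<parallel>\<^sub>1 = 1\<close>. A profile \<open>g\<close> that vanishes on \<open>[-1, 1/2]\<close> gives a ridge function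
  \<open>g (a \<bullet> x)\<close> that can only be noticed at points \<open>x\<close> with \<open>\<sigma> \<bullet> x > d / 2\<close>. By an exponential moment
  bound (lemma \<open>card_correlated_signs\<close>) a fixed point \<open>x\<close> of the cube has this property for an
  exponentially small fraction of the sign vectors only. Hence fewer than \<open>\<gamma> ^ d\<close> points, where
  \<open>\<gamma> = 4 * sqrt 2 / 5 > 1\<close>, miss the ridge function of some \<open>\<sigma>\<close> entirely
  (lemma \<open>exists_uncorrelated_sign\<close>), although at the vertex \<open>x = \<sigma>\<close> that function takes the value
  \<open>g 1\<close>, a positive constant that does not depend on \<open>d\<close>.

  Adaptive sampling does not help. When all observed values are zero, the sample points are those
  that the algorithm selects for the zero function, so they are known before \<open>\<sigma>\<close> is chosen. The
  algorithm then returns the same answer for the profiles \<open>g\<close> and \<open>-g\<close> and errs by at least \<open>g 1\<close>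
  for one of them (lemma \<open>sampling_err_ge\<close>).

  As profile serves a multiple of \<open>max 0 (u - 1/2) ^ (m + 1)\<close>, where \<open>m\<close> is the order of
  differentiability. Its \<open>m\<close>-th derivative is Lipschitz and bounded. As the Hoelder seminorm divides
  by a power of \<open>min 1 \<bar>u - v\<bar>\<close> with exponent \<open>r - m \<le> 1\<close>, this is enough.

  For \<open>p = 1\<close> the two norm constraints of the second class together say \<open>\<parallel>a\<parallel>\<^sub>1 = 1\<close>, so the second class is the first one.
\<close>

section \<open>Sign vectors that correlate weakly with finitely many points\<close>

definition signs :: "nat \<Rightarrow> (nat \<Rightarrow> real) set" where
  "signs d = {..<d} \<rightarrow>\<^sub>E {-1, 1}"

lemma finite_signs: "finite (signs d)"
  by (simp add: signs_def finite_PiE)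

lemma card_signs: "card (signs d) = 2 ^ d"
  by (simp add: signs_def card_PiE numeral_2_eq_2)

lemma signs_subset_cube: "signs d \<subseteq> cube d"
  unfolding signs_def cube_def by (rule PiE_mono) auto

text \<open>The left-hand side is convex in \<open>t\<close>, so it is largest at the end points; in terms of
  \<open>s = 2 powr t\<close> the claim is that \<open>s\<close> lies between the roots \<open>1/2\<close> and \<open>2\<close> of a quadratic.\<close>

lemma two_powr_plus_inverse_le:
  fixes t :: real
  assumes "\<bar>t\<bar> \<le> 1"
  shows "2 powr t + 2 powr (- t) \<le> 5 / 2"
proof -
  define s :: real where "s = 2 powr t"
  have "2 powr (-1) \<le> s" "s \<le> 2 powr 1"
    unfolding s_def using assms by (intro powr_mono; simp)+
  then have s: "1 / 2 \<le> s" "s \<le> 2"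
    by (simp_all add: powr_minus)
  have "(s - 1 / 2) * (s - 2) \<le> 0"
    using s by (intro mult_nonneg_nonpos) auto
  also have "(s - 1 / 2) * (s - 2) = s * s + 1 - 5 / 2 * s"
    by (simp add: field_simps)
  finally have "s * s + 1 \<le> 5 / 2 * s"
    by simp
  then have "(s * s + 1) / s \<le> 5 / 2"
    using s by (simp add: pos_divide_le_eq)
  then have "s + 1 / s \<le> 5 / 2"
    using s by (simp add: add_divide_distrib)
  then show ?thesis
    by (simp add: s_def powr_minus_divide)
qed

text \<open>
  Markov's inequality for \<open>2 powr (\<sigma> \<bullet> x)\<close> under the uniform distribution of \<open>\<sigma>\<close>: its
  expectation factorises over the coordinates. Base 2 and threshold \<open>d / 2\<close> are convenient because
  the resulting rate \<open>sqrt 2 / (5/4)\<close> exceeds 1.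
\<close>

lemma card_correlated_signs:
  assumes "x \<in> cube d"
  shows "real (card {\<sigma> \<in> signs d. real d / 2 < (\<Sum>i<d. \<sigma> i * x i)}) * sqrt 2 ^ d \<le> (5 / 2) ^ d"
    (is "real (card ?B) * _ \<le> _")
proof -
  have fin: "finite ?B"
    using finite_signs by simp
  have sqrt2: "sqrt 2 ^ d = 2 powr (real d / 2)"
    by (simp add: powr_half_sqrt [symmetric] powr_realpow [symmetric] powr_powr)
  have "real (card ?B) * sqrt 2 ^ d = (\<Sum>\<sigma>\<in>?B. 2 powr (real d / 2))"
    by (simp add: sqrt2)
  also have "\<dots> \<le> (\<Sum>\<sigma>\<in>?B. 2 powr (\<Sum>i<d. \<sigma> i * x i))"
    by (intro sum_mono powr_mono) auto
  also have "\<dots> \<le> (\<Sum>\<sigma>\<in>signs d. 2 powr (\<Sum>i<d. \<sigma> i * x i))"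
    by (intro sum_mono2 finite_signs) auto
  also have "\<dots> = (\<Sum>\<sigma>\<in>signs d. \<Prod>i<d. 2 powr (\<sigma> i * x i))"
    by (simp add: powr_sum)
  also have "\<dots> = (\<Prod>i<d. \<Sum>s\<in>{-1, 1}. 2 powr (s * x i))"
    unfolding signs_def by (subst prod_sum_PiE) auto
  also have "\<dots> \<le> (\<Prod>i<d. 5 / 2)"
  proof (intro prod_mono conjI)
    fix i assume "i \<in> {..<d}"
    then have "\<bar>x i\<bar> \<le> 1"
      using assms by (auto simp: cube_def PiE_iff abs_le_iff)
    then show "(\<Sum>s\<in>{-1, 1}. 2 powr (s * x i)) \<le> 5 / 2"
      using two_powr_plus_inverse_le [of "x i"] by simp
  qed (auto intro: sum_nonneg)
  finally show ?thesis
    by simp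
qed

text \<open>A union bound: the exceptional sign vectors of the points in \<open>X\<close> do not exhaust all.\<close>

lemma exists_uncorrelated_sign:
  assumes "finite X" "X \<subseteq> cube d" "real (card X) < (4 * sqrt 2 / 5) ^ d"
  shows "\<exists>\<sigma>\<in>signs d. \<forall>x\<in>X. (\<Sum>i<d. \<sigma> i * x i) \<le> real d / 2"
proof (rule ccontr)
  define B where "B x = {\<sigma> \<in> signs d. real d / 2 < (\<Sum>i<d. \<sigma> i * x i)}" for x
  assume "\<not> ?thesis"
  then have "signs d \<subseteq> (\<Union>x\<in>X. B x)"
    by (force simp: B_def)
  moreover have "finite (\<Union>x\<in>X. B x)"
    using assms(1) finite_signs by (auto simp: B_def)
  ultimately have "card (signs d) \<le> card (\<Union>x\<in>X. B x)"
    by (rule card_mono [rotated])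
  also have "\<dots> \<le> (\<Sum>x\<in>X. card (B x))"
    using assms(1) by (rule card_UN_le)
  finally have "real (2 ^ d) \<le> real (\<Sum>x\<in>X. card (B x))"
    unfolding card_signs of_nat_le_iff .
  then have "2 ^ d \<le> (\<Sum>x\<in>X. real (card (B x)))"
    by simp
  then have "2 ^ d * sqrt 2 ^ d \<le> (\<Sum>x\<in>X. real (card (B x)) * sqrt 2 ^ d)"
    by (simp flip: sum_distrib_right)
  also have "\<dots> \<le> (\<Sum>x\<in>X. (5 / 2) ^ d)"
    using assms(2) card_correlated_signs unfolding B_def by (intro sum_mono) blast
  also have "\<dots> = real (card X) * (5 / 2) ^ d"
    by simp
  also have "\<dots> < (4 * sqrt 2 / 5) ^ d * (5 / 2) ^ d"
    using assms(3) by (intro mult_strict_right_mono) auto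
  also have "\<dots> = 2 ^ d * sqrt 2 ^ d"
    unfolding power_mult_distrib [symmetric] by (simp add: mult.commute)
  finally show False
    by simp
qed

section \<open>A profile supported in \<open>[1/2, 1]\<close>\<close>

text \<open>
  Away from the kink the function is locally a polynomial or zero. At the kink itself,
  \<open>max 0 t ^ (n + 1)\<close> is a continuous slope function in the sense of Caratheodory.
\<close>

lemma has_real_derivative_pos_part_power:
  fixes u b :: real
  shows "((\<lambda>u. max 0 (u - b) ^ (n + 2)) has_real_derivative (real n + 2) * max 0 (u - b) ^ (n + 1))
           (at u)"
proof (cases u b rule: linorder_cases)
  case less
  have "((\<lambda>u. 0) has_real_derivative 0) (at u)"
    by simp
  then have "((\<lambda>u. max 0 (u - b) ^ (n + 2)) has_real_derivative 0) (at u)"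
    by (rule has_field_derivative_transform_within_open [where S = "{..<b}"])
      (use less in auto)
  then show ?thesis
    using less by simp
next
  case equal
  have "max 0 (z - b) ^ (n + 2) = max 0 (z - b) ^ (n + 1) * (z - b)" for z
    by (auto simp: max_def)
  moreover have "isCont (\<lambda>z. max 0 (z - b) ^ (n + 1)) u"
    by (intro continuous_intros)
  ultimately show ?thesis
    unfolding CARAT_DERIV using equal by (intro exI [of _ "\<lambda>z. max 0 (z - b) ^ (n + 1)"]) auto
next
  case greater
  have "((\<lambda>u. (u - b) ^ (n + 2)) has_real_derivative (real n + 2) * (u - b) ^ (n + 1)) (at u)"
    by (rule DERIV_cong [OF DERIV_power]) (auto intro!: derivative_eq_intros)
  then have "((\<lambda>u. max 0 (u - b) ^ (n + 2)) has_real_derivative (real n + 2) * (u - b) ^ (n + 1))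
      (at u)"
    by (rule has_field_derivative_transform_within_open [where S = "{b<..}"])
      (use greater in auto)
  then show ?thesis
    using greater by simp
qed

definition kink_profile :: "nat \<Rightarrow> real \<Rightarrow> real \<Rightarrow> real" where
  "kink_profile m c u = c * max 0 (u - 1 / 2) ^ (m + 1)"

definition kink_deriv :: "nat \<Rightarrow> real \<Rightarrow> nat \<Rightarrow> real \<Rightarrow> real" where
  "kink_deriv m c k u = c * (fact (m + 1) / fact (m + 1 - k)) * max 0 (u - 1 / 2) ^ (m + 1 - k)"

lemma has_vector_derivative_kink_deriv:
  assumes "k < m"
  shows "(kink_deriv m c k has_vector_derivative kink_deriv m c (Suc k) u) (at u within A)"
proof -
  obtain n where n: "m = k + n + 1"
    using assms less_iff_Suc_add by auto
  have exps: "m + 1 - k = n + 2" "m + 1 - Suc k = n + 1"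
    by (simp_all add: n)
  have coeff: "fact (m + 1) / fact (n + 2) * (real n + 2) = (fact (m + 1) / fact (n + 1) :: real)"
    using fact_Suc [of "n + 1", where 'a = real]
    by (simp add: field_simps del: fact_Suc of_nat_Suc) (simp add: algebra_simps)
  have "((\<lambda>u. c * (fact (m + 1) / fact (n + 2)) * max 0 (u - 1 / 2) ^ (n + 2)) has_real_derivative
      c * (fact (m + 1) / fact (n + 2)) * ((real n + 2) * max 0 (u - 1 / 2) ^ (n + 1))) (at u)"
    by (rule DERIV_cmult [OF has_real_derivative_pos_part_power])
  also have "c * (fact (m + 1) / fact (n + 2)) * ((real n + 2) * max 0 (u - 1 / 2) ^ (n + 1))
      = kink_deriv m c (Suc k) u"
    unfolding kink_deriv_def exps coeff [symmetric] by (simp only: mult.assoc)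
  finally have "(kink_deriv m c k has_real_derivative kink_deriv m c (Suc k) u) (at u)"
    unfolding kink_deriv_def exps .
  then show ?thesis
    by (simp add: has_real_derivative_iff_has_vector_derivative has_vector_derivative_at_within)
qed

lemma nderiv_kink_profile:
  assumes "k \<le> m" "u \<in> {-1..1}"
  shows "nderiv k (kink_profile m c) u = kink_deriv m c k u"
  using assms
proof (induction k arbitrary: u)
  case 0
  then show ?case
    by (simp add: nderiv_def kink_profile_def kink_deriv_def)
next
  case (Suc k)
  have "(nderiv k (kink_profile m c) has_vector_derivative kink_deriv m c (Suc k) u)
      (at u within {-1..1})"
    by (rule has_vector_derivative_transform [OF _ _ has_vector_derivative_kink_deriv])
      (use Suc in auto)
  then have "vector_derivative (nderiv k (kink_profile m c)) (at u within {-1..1})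
      = kink_deriv m c (Suc k) u"
    using Suc.prems by (intro vector_derivative_within_closed_interval) auto
  then show ?case
    by (simp add: nderiv_def)
qed

lemma cont_differentiable_kink_profile: "cont_differentiable m (kink_profile m c)"
  unfolding cont_differentiable_def
proof (intro conjI allI impI)
  fix k assume "k < m"
  then have "(nderiv k (kink_profile m c) has_vector_derivative kink_deriv m c (Suc k) u)
      (at u within {-1..1})" if "u \<in> {-1..1}" for u
    by (intro has_vector_derivative_transform [OF that _ has_vector_derivative_kink_deriv])
      (simp_all add: nderiv_kink_profile)
  then show "nderiv k (kink_profile m c) differentiable_on {-1..1}"
    unfolding differentiable_on_def by (blast intro: differentiableI_vector)
next
  have "continuous_on {-1..1} (kink_deriv m c m)"
    unfolding kink_deriv_def by (intro continuous_intros)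
  then show "continuous_on {-1..1} (nderiv m (kink_profile m c))"
    by (subst continuous_on_cong [OF refl nderiv_kink_profile]) auto
qed

lemma abs_kink_deriv_le:
  assumes "\<bar>c\<bar> * fact (m + 1) \<le> 1" "u \<in> {-1..1}"
  shows "\<bar>kink_deriv m c k u\<bar> \<le> 1"
proof -
  have "fact (m + 1) / fact (m + 1 - k) \<le> (fact (m + 1) :: real)"
    by (simp add: divide_le_eq del: fact_Suc)
  then have "\<bar>c\<bar> * (fact (m + 1) / fact (m + 1 - k)) \<le> 1"
    using assms(1) by (meson abs_ge_zero mult_left_mono order_trans)
  moreover have "max 0 (u - 1 / 2) ^ (m + 1 - k) \<le> 1"
    using assms(2) by (intro power_le_one) auto
  ultimately have "\<bar>c\<bar> * (fact (m + 1) / fact (m + 1 - k)) * max 0 (u - 1 / 2) ^ (m + 1 - k) \<le> 1 * 1"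
    by (intro mult_mono) auto
  then show ?thesis
    by (simp add: kink_deriv_def abs_mult del: fact_Suc)
qed

text \<open>
  The highest derivative is a multiple of \<open>max 0 (u - 1/2)\<close>. It has Lipschitz constant 1 and
  oscillation at most 1, and \<open>t \<le> t powr \<beta>\<close> for \<open>0 < t \<le> 1\<close> and \<open>\<beta> \<le> 1\<close>.
\<close>

lemma kink_deriv_holder:
  assumes "\<bar>c\<bar> * fact (m + 1) \<le> 1" "u \<in> {-1..1}" "v \<in> {-1..1}" "u \<noteq> v" "\<beta> \<le> 1"
  shows "\<bar>kink_deriv m c m u - kink_deriv m c m v\<bar> / (2 * min 1 \<bar>u - v\<bar> powr \<beta>) \<le> 1"
proof -
  define t where "t = min 1 \<bar>u - v\<bar>"
  have t: "0 < t" "t \<le> 1"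
    using assms by (auto simp: t_def)
  have "\<bar>max 0 (u - 1 / 2) - max 0 (v - 1 / 2)\<bar> \<le> t"
    using assms by (auto simp: t_def)
  then have "\<bar>c\<bar> * fact (m + 1) * \<bar>max 0 (u - 1 / 2) - max 0 (v - 1 / 2)\<bar> \<le> 1 * t"
    using assms(1) t by (intro mult_mono) auto
  then have "\<bar>kink_deriv m c m u - kink_deriv m c m v\<bar> \<le> t"
    by (simp add: kink_deriv_def abs_mult flip: right_diff_distrib del: fact_Suc)
  also have "t \<le> 2 * t powr \<beta>"
    using powr_mono' [of \<beta> 1 t] t assms(5) by simp
  finally show ?thesis
    using t by (simp add: divide_le_eq flip: t_def)
qed

lemma lip_order_ge:
  assumes "r > 0"
  shows "r - real (lip_order r) \<le> 1"
proof (rule ccontr)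
  assume "\<not> ?thesis"
  then have "real (Suc (lip_order r)) < r"
    by simp
  moreover have "k \<le> nat \<lceil>r\<rceil>" if "real k < r" for k
    using that by linarith
  ultimately have "Suc (lip_order r) \<le> lip_order r"
    unfolding lip_order_def by (intro Greatest_le_nat) auto
  then show False
    by simp
qed

lemma kink_profile_in_lip_ball:
  assumes "r > 0" "\<bar>c\<bar> * fact (lip_order r + 1) \<le> 1"
  shows "kink_profile (lip_order r) c \<in> lip_ball r"
proof -
  let ?m = "lip_order r"
  have "holder_seminorm (r - real ?m) (nderiv ?m (kink_profile ?m c)) \<le> 1"
    unfolding holder_seminorm_def
    using kink_deriv_holder [OF assms(2)] lip_order_ge [OF assms(1)]
    by (auto intro!: SUP_least simp: nderiv_kink_profile)
  moreover have "sup_norm {-1..1} (nderiv k (kink_profile ?m c)) \<le> 1" if "k \<le> ?m" for k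
    unfolding sup_norm_def
    using that abs_kink_deriv_le [OF assms(2)]
    by (auto intro!: SUP_least simp: nderiv_kink_profile)
  ultimately show ?thesis
    unfolding lip_ball_def Let_def
    using cont_differentiable_kink_profile [of ?m c] by simp
qed

section \<open>Lower bounds for adaptive sampling\<close>

text \<open>
  By induction every observed value is zero, so each selection coincides with the selection made
  for the zero function.
\<close>

lemma observed_eq_zero_run:
  assumes "\<And>k. k < n \<Longrightarrow> f (\<psi> (observed \<psi> (\<lambda>_. 0) k)) = 0"
  shows "observed \<psi> f n = observed \<psi> (\<lambda>_. 0) n"
  using assms by (induction n) auto

lemma length_observed [simp]: "length (observed \<psi> f n) = n"
  by (induction n) auto

text \<open>
  Two functions that vanish at all points selected for the zero function receive the same answer
  \<open>A f\<close>, and the triangle inequality forces an error of half their distance on one of them.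
\<close>

lemma sampling_err_ge:
  assumes fool: "\<And>X. finite X \<Longrightarrow> X \<subseteq> cube d \<Longrightarrow> card X \<le> n \<Longrightarrow>
      \<exists>f\<in>F. \<exists>f'\<in>F. \<exists>y\<in>cube d. (\<forall>x\<in>X. f x = 0 \<and> f' x = 0) \<and> 2 * \<delta> \<le> \<bar>f y - f' y\<bar>"
  shows "ennreal \<delta> \<le> sampling_err d n F"
  unfolding sampling_err_def
proof (rule INF_greatest)
  fix A assume "A \<in> sampling_algorithms d n"
  then obtain \<phi> \<psi> where A: "A = (\<lambda>f. \<phi> (observed \<psi> f n))"
    and \<psi>: "\<And>ys. length ys < n \<Longrightarrow> \<psi> ys \<in> cube d"
    unfolding sampling_algorithms_def by blast
  define X where "X = (\<lambda>k. \<psi> (observed \<psi> (\<lambda>_. 0) k)) ` {..<n}"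
  have "finite X" "X \<subseteq> cube d" "card X \<le> n"
    using \<psi> card_image_le [of "{..<n}"] by (auto simp: X_def)
  from fool [OF this] obtain f f' y where f: "f \<in> F" "f' \<in> F" and y: "y \<in> cube d"
    and zero: "\<And>x. x \<in> X \<Longrightarrow> f x = 0 \<and> f' x = 0" and dist: "2 * \<delta> \<le> \<bar>f y - f' y\<bar>"
    by blast
  have "observed \<psi> f n = observed \<psi> (\<lambda>_. 0) n" "observed \<psi> f' n = observed \<psi> (\<lambda>_. 0) n"
    by (rule observed_eq_zero_run; use zero in \<open>auto simp: X_def\<close>)+
  then have "A f = A f'"
    by (simp add: A)
  then have "\<delta> \<le> \<bar>f y - A f y\<bar> \<or> \<delta> \<le> \<bar>f' y - A f' y\<bar>"
    using dist by auto
  then obtain h where h: "h \<in> F" "\<delta> \<le> \<bar>h y - A h y\<bar>"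
    using f by blast
  have "ennreal \<delta> \<le> ennreal \<bar>h y - A h y\<bar>"
    using h(2) by (rule ennreal_leI)
  also have "\<dots> \<le> sup_norm (cube d) (\<lambda>x. h x - A h x)"
    unfolding sup_norm_def using y by (rule SUP_upper)
  also have "\<dots> \<le> (SUP f\<in>F. sup_norm (cube d) (\<lambda>x. f x - A f x))"
    using h(1) by (rule SUP_upper)
  finally show "ennreal \<delta> \<le> (SUP f\<in>F. sup_norm (cube d) (\<lambda>x. f x - A f x))" .
qed

lemma info_complexity_ge:
  assumes "\<And>n. real n < b \<Longrightarrow> ennreal \<delta> \<le> sampling_err d n F" "0 \<le> \<epsilon>" "\<epsilon> < \<delta>"
  shows "ereal b \<le> ereal_of_enat (info_complexity d \<epsilon> F)"
proof -
  have "enat (nat \<lceil>b\<rceil>) \<le> info_complexity d \<epsilon> F"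
    unfolding info_complexity_def
  proof (rule INF_greatest)
    fix n assume "n \<in> {n. sampling_err d n F \<le> ennreal \<epsilon>}"
    then have "\<not> ennreal \<delta> \<le> sampling_err d n F"
      using assms(2,3) by (metis ennreal_less_iff mem_Collect_eq not_le order_trans)
    then have "b \<le> real n"
      using assms(1) by force
    then show "enat (nat \<lceil>b\<rceil>) \<le> enat n"
      by (simp add: nat_le_iff ceiling_le_iff)
  qed
  then have "ereal_of_enat (enat (nat \<lceil>b\<rceil>)) \<le> ereal_of_enat (info_complexity d \<epsilon> F)"
    by (simp only: ereal_of_enat_le_iff)
  moreover have "ereal b \<le> ereal_of_enat (enat (nat \<lceil>b\<rceil>))"
    by (simp add: of_nat_ceiling)
  ultimately show ?thesis
    by (rule order_trans [rotated])
qed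

section \<open>The curse of dimensionality for ridge functions\<close>

definition sign_direction :: "nat \<Rightarrow> (nat \<Rightarrow> real) \<Rightarrow> nat \<Rightarrow> real" where
  "sign_direction d \<sigma> = (\<lambda>i\<in>{..<d}. \<sigma> i / real d)"

lemma sum_sign_direction:
  "(\<Sum>i<d. sign_direction d \<sigma> i * x i) = (\<Sum>i<d. \<sigma> i * x i) / real d"
  by (simp add: sign_direction_def sum_divide_distrib)

lemma lp_norm_sign_direction:
  assumes "\<sigma> \<in> signs d" "d \<ge> 1"
  shows "lp_norm 1 d (sign_direction d \<sigma>) = 1"
proof -
  have "\<bar>\<sigma> i\<bar> = 1" if "i < d" for i
    using assms that by (force simp: signs_def PiE_iff)
  then have "(\<Sum>i<d. \<bar>sign_direction d \<sigma> i\<bar> powr 1) = (\<Sum>i<d. 1 / real d)"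
    by (intro sum.cong) (auto simp: sign_direction_def abs_divide)
  then show ?thesis
    using assms by (simp add: lp_norm_def)
qed

lemma ridge_class_sampling_err_ge:
  assumes "r > 0" "d \<ge> 1" "real n < (4 * sqrt 2 / 5) ^ d"
  shows "ennreal ((1 / 2) ^ (lip_order r + 1) / fact (lip_order r + 1))
           \<le> sampling_err d n (ridge_class r d)"
proof (rule sampling_err_ge)
  define m where "m = lip_order r"
  fix X assume X: "finite X" "X \<subseteq> cube d" "card X \<le> n"
  then have "real (card X) < (4 * sqrt 2 / 5) ^ d"
    using assms(3) by linarith
  from exists_uncorrelated_sign [OF X(1,2) this] obtain \<sigma> where \<sigma>: "\<sigma> \<in> signs d"
    and unc: "\<And>x. x \<in> X \<Longrightarrow> (\<Sum>i<d. \<sigma> i * x i) \<le> real d / 2"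
    by blast
  have \<sigma>_cube: "\<sigma> \<in> cube d"
    using \<sigma> signs_subset_cube by blast
  define f where "f c = ridge d (kink_profile m c) (sign_direction d \<sigma>)" for c
  have f: "f c \<in> ridge_class r d" if "\<bar>c\<bar> * fact (m + 1) \<le> 1" for c
  proof -
    have "sign_direction d \<sigma> \<in> {..<d} \<rightarrow>\<^sub>E UNIV"
      by (simp add: sign_direction_def)
    then show ?thesis
      using kink_profile_in_lip_ball [OF assms(1)] that lp_norm_sign_direction [OF \<sigma> assms(2)]
      unfolding f_def ridge_class_def m_def by blast
  qed
  have f_zero: "f c x = 0" if "x \<in> X" for c x
  proof -
    have "(\<Sum>i<d. \<sigma> i * x i) / real d \<le> 1 / 2"
      using unc [OF that] assms(2) by (simp add: field_simps)
    then show ?thesis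
      using that X(2) by (auto simp: f_def ridge_def kink_profile_def sum_sign_direction)
  qed
  have "\<sigma> i * \<sigma> i = 1" if "i < d" for i
    using \<sigma> that by (force simp: signs_def PiE_iff)
  then have "(\<Sum>i<d. \<sigma> i * \<sigma> i) / real d = 1"
    using assms(2) by simp
  then have f_vertex: "f c \<sigma> = c * (1 / 2) ^ (m + 1)" for c
    using \<sigma>_cube by (simp add: f_def ridge_def kink_profile_def sum_sign_direction)
  let ?c = "1 / fact (m + 1) :: real"
  show "\<exists>f\<in>ridge_class r d. \<exists>f'\<in>ridge_class r d. \<exists>y\<in>cube d. (\<forall>x\<in>X. f x = 0 \<and> f' x = 0) \<and>
      2 * ((1 / 2) ^ (lip_order r + 1) / fact (lip_order r + 1)) \<le> \<bar>f y - f' y\<bar>"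
  proof (rule bexI [of _ "f ?c"], rule bexI [of _ "f (- ?c)"], rule bexI [of _ \<sigma>],
      intro conjI ballI)
    show "f ?c \<in> ridge_class r d" "f (- ?c) \<in> ridge_class r d"
      by (intro f; simp del: fact_Suc)+
    show "2 * ((1 / 2) ^ (lip_order r + 1) / fact (lip_order r + 1)) \<le> \<bar>f ?c \<sigma> - f (- ?c) \<sigma>\<bar>"
      by (simp add: f_vertex m_def del: fact_Suc)
  qed (use f_zero \<sigma>_cube in auto)
qed

lemma curse_of_dimensionality_ridge_class:
  assumes "r > 0" "\<And>d. d \<ge> 1 \<Longrightarrow> F d = ridge_class r d"
  shows "curse_of_dimensionality F"
proof -
  define \<delta> :: real where "\<delta> = (1 / 2) ^ (lip_order r + 1) / fact (lip_order r + 1)"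
  have \<delta>: "\<delta> > 0"
    by (simp add: \<delta>_def del: fact_Suc)
  \<comment> \<open>Half of \<open>\<delta>\<close>, because an error of exactly \<open>\<delta>\<close> is not excluded by the lower bound.\<close>
  have bound: "ereal (1 * (4 * sqrt 2 / 5) ^ d) \<le> ereal_of_enat (info_complexity d \<epsilon> (F d))"
    if "d \<ge> 1" "0 < \<epsilon>" "\<epsilon> \<le> \<delta> / 2" for d \<epsilon>
  proof (rule info_complexity_ge)
    fix n assume "real n < 1 * (4 * sqrt 2 / 5) ^ d"
    then show "ennreal \<delta> \<le> sampling_err d n (F d)"
      unfolding \<delta>_def assms(2) [OF that(1)]
      using assms(1) that(1) by (intro ridge_class_sampling_err_ge) simp_all
  next
    show "0 \<le> \<epsilon>" "\<epsilon> < \<delta>"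
      using that \<delta> by linarith+
  qed
  have "\<exists>\<^sub>\<infinity>d. \<forall>\<epsilon>. 0 < \<epsilon> \<and> \<epsilon> \<le> \<delta> / 2 \<longrightarrow>
      ereal (1 * (4 * sqrt 2 / 5) ^ d) \<le> ereal_of_enat (info_complexity d \<epsilon> (F d))"
    unfolding INFM_nat
  proof
    fix N
    show "\<exists>d>N. \<forall>\<epsilon>. 0 < \<epsilon> \<and> \<epsilon> \<le> \<delta> / 2 \<longrightarrow>
        ereal (1 * (4 * sqrt 2 / 5) ^ d) \<le> ereal_of_enat (info_complexity d \<epsilon> (F d))"
      by (intro exI [of _ "Suc N"] conjI allI impI bound) auto
  qed
  moreover have "(1 :: real) < 4 * sqrt 2 / 5"
    using real_less_rsqrt [of "5 / 4" 2] by (simp add: power2_eq_square)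
  ultimately show ?thesis
    unfolding curse_of_dimensionality_def using \<delta>
    by (intro exI [of _ 1] exI [of _ "4 * sqrt 2 / 5"] exI [of _ "\<delta> / 2"] conjI) simp_all
qed

lemma ridge_class_lp_one:
  assumes "S \<ge> 1"
  shows "ridge_class_lp r 1 S d = ridge_class r d"
proof -
  have "lp_norm 1 d a \<le> 1 \<and> lp_norm 1 d a \<ge> min 1 (4 * real S powr (1 - 1 / 1))
      \<longleftrightarrow> lp_norm 1 d a = 1" for a
    using assms by auto
  then show ?thesis
    by (simp only: ridge_class_lp_def ridge_class_def)
qed

theorem corollary9:
  fixes r :: real and S :: "nat \<Rightarrow> nat"
  assumes "r > 0"
    and "\<And>d. d \<ge> 1 \<Longrightarrow> S d \<in> {1..d}"
  shows "curse_of_dimensionality (\<lambda>d. ridge_class r d) \<and>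
         curse_of_dimensionality (\<lambda>d. ridge_class_lp r 1 (S d) d)"
  using assms
  by (intro conjI curse_of_dimensionality_ridge_class [OF assms(1)])
    (auto simp: ridge_class_lp_one)

end
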